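(* Let $G$ be a bipartite graph, and let $H_1$ and $H_2$ be two equivalent symmetric $d\times d$ complex Hadamard matrices. Then the generalized graph states $|\psi_{G,H_1}\rangle$ and $|\psi_{G,H_2}\rangle$ are LU equivalent.
   Context: A complex Hadamard matrix of size $d$ is a $d\times d$ complex matrix $H=(h_{ij})_{i,j=0}^{d-1}$ with $|h_{ij}|=1$ for all $i,j$ and $H^\dagger H=dI_d$; it is symmetric if $H=H^T$. Two $d\times d$ Hadamard matrices $H_1,H_2$ are equivalent if there exist $d\times d$ permutation matrices $P_1,P_2$ and $d\times d$ diagonal matrices $D_1,D_2$ such that $H_1=D_1P_1H_2P_2D_2$. A graph $G$ is bipartite if its vertex set is the disjoint union of two sets $V_1,V_2$ such that every edge of $G$ joins a vertex of $V_1$ to a vertex of $V_2$. A qudit has state space $\mathbb{C}^d$ with computational basis $|0\rangle,\dots,|d-1\rangle$. For symmetric $H$, the generalized controlled-$Z$ gate $C^H$ is the diagonal operator on $\mathbb{C}^d\otimes\mathbb{C}^d$ with $C^H|ij\rangle=h_{ij}|ij\rangle$; $C^H_{ab}$ denotes this gate acting on qudits $a,b$ of an $n$-qudit system. For a (finite, simple) undirected graph $G$ with vertex set $V(G)=\{1,\dots,n\}$ and edge set $E(G)$, the generalized graph state in $(\mathbb{C}^d)^{\otimes n}$ is $$|\psi_{G,H}\rangle=\mathcal{U}_{G,H}|0\rangle^{\otimes n},\qquad \mathcal{U}_{G,H}=\frac{1}{d^{n/2}}\Big(\prod_{ab\in E(G)}C^H_{ab}\Big)H^{\otimes n}.$$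 Two $n$-qudit states $|\psi_1\rangle,|\psi_2\rangle$ are LU (local unitary) equivalent if there are single-qudit unitaries $U_1,\dots,U_n$ with $(U_1\otimes\cdots\otimes U_n)|\psi_1\rangle=|\psi_2\rangle$. *)

theory Defs
  imports
    "Jordan_Normal_Form.Schur_Decomposition"
    "HOL-Combinatorics.Permutations"
    "HOL-Library.FuncSet"
begin

subsection \<open>Complex Hadamard matrices\<close>

definition hadamard_mat :: "nat \<Rightarrow> complex mat \<Rightarrow> bool" where
  "hadamard_mat d H \<longleftrightarrow>
     H \<in> carrier_mat d d \<and>
     (\<forall>i<d. \<forall>j<d. cmod (H $$ (i, j)) = 1) \<and>
     mat_adjoint H * H = of_nat d \<cdot>\<^sub>m 1\<^sub>m d"

definition symmetric_mat :: "'a mat \<Rightarrow> bool" where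
  "symmetric_mat A \<longleftrightarrow> A = transpose_mat A"

definition permutation_mat :: "nat \<Rightarrow> complex mat \<Rightarrow> bool" where
  "permutation_mat d P \<longleftrightarrow>
     (\<exists>\<pi>. \<pi> permutes {0..<d} \<and> P = mat d d (\<lambda>(i, j). if i = \<pi> j then 1 else 0))"

definition hadamard_equiv :: "nat \<Rightarrow> complex mat \<Rightarrow> complex mat \<Rightarrow> bool" where
  "hadamard_equiv d H1 H2 \<longleftrightarrow>
     (\<exists>P1 P2 D1 D2.
        permutation_mat d P1 \<and> permutation_mat d P2 \<and>
        D1 \<in> carrier_mat d d \<and> diagonal_mat D1 \<and>
        D2 \<in> carrier_mat d d \<and> diagonal_mat D2 \<and>
        H1 = D1 * P1 * H2 * P2 * D2)"

definition unitary_mat :: "nat \<Rightarrow> complex mat \<Rightarrow> bool" where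
  "unitary_mat d U \<longleftrightarrow> U \<in> carrier_mat d d \<and> mat_adjoint U * U = 1\<^sub>m d"


subsection \<open>Finite simple graphs on the vertices 1, ..., n\<close>

text \<open>A graph is given by its edge set; an edge is a two-element set of vertices.\<close>

definition simple_graph :: "nat \<Rightarrow> nat set set \<Rightarrow> bool" where
  "simple_graph n E \<longleftrightarrow> (\<forall>e\<in>E. e \<subseteq> {1..n} \<and> card e = 2)"

definition bipartite :: "nat \<Rightarrow> nat set set \<Rightarrow> bool" where
  "bipartite n E \<longleftrightarrow>
     (\<exists>V1 V2. V1 \<union> V2 = {1..n} \<and> V1 \<inter> V2 = {} \<and>
        (\<forall>e\<in>E. \<exists>a\<in>V1. \<exists>b\<in>V2. e = {a, b}))"


subsection \<open>Systems of n qudits\<close>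

text \<open>
  The computational basis of the n-fold tensor power of the d-dimensional space consists of the
  vectors \<open>|c(1) ... c(n)\<rangle>\<close>, where c ranges over \<open>basis_labels n d\<close>. A vector is represented by the
  family of its coordinates in this basis, extended by 0 to all other functions, so that equality
  of vectors is equality of functions.
\<close>

definition basis_labels :: "nat \<Rightarrow> nat \<Rightarrow> (nat \<Rightarrow> nat) set" where
  "basis_labels n d = ({1..n} \<rightarrow>\<^sub>E {0..<d})"

type_synonym qvec = "(nat \<Rightarrow> nat) \<Rightarrow> complex"

definition qudit_space :: "nat \<Rightarrow> nat \<Rightarrow> qvec set" where
  "qudit_space n d = {\<psi>. \<forall>x. x \<notin> basis_labels n d \<longrightarrow> \<psi> x = 0}"

definition ket :: "(nat \<Rightarrow> nat) \<Rightarrow> qvec" where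
  "ket c = (\<lambda>x. if x = c then 1 else 0)"

definition ket_zero :: "nat \<Rightarrow> qvec" where
  "ket_zero n = ket (\<lambda>v\<in>{1..n}. 0)"

text \<open>The operator \<open>A(1) \<otimes> ... \<otimes> A(n)\<close>, whose matrix entries are products of entries of the factors.\<close>

definition tensor_op :: "nat \<Rightarrow> nat \<Rightarrow> (nat \<Rightarrow> complex mat) \<Rightarrow> qvec \<Rightarrow> qvec" where
  "tensor_op n d A \<psi> =
     (\<lambda>x. if x \<in> basis_labels n d
          then \<Sum>y\<in>basis_labels n d. (\<Prod>v\<in>{1..n}. A v $$ (x v, y v)) * \<psi> y
          else 0)"

definition lu_equiv :: "nat \<Rightarrow> nat \<Rightarrow> qvec \<Rightarrow> qvec \<Rightarrow> bool" where
  "lu_equiv n d \<psi>1 \<psi>2 \<longleftrightarrow>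
     \<psi>1 \<in> qudit_space n d \<and> \<psi>2 \<in> qudit_space n d \<and>
     (\<exists>U. (\<forall>v\<in>{1..n}. unitary_mat d (U v)) \<and> tensor_op n d U \<psi>1 = \<psi>2)"


subsection \<open>Generalized graph states\<close>

definition cz_gate :: "complex mat \<Rightarrow> nat \<Rightarrow> nat \<Rightarrow> qvec \<Rightarrow> qvec" where
  "cz_gate H a b \<psi> = (\<lambda>x. H $$ (x a, x b) * \<psi> x)"

lemma cz_gate_ket: "cz_gate H a b (ket c) = (\<lambda>x. H $$ (c a, c b) * ket c x)"
  by (auto simp: cz_gate_def ket_def)

text \<open>
  For symmetric H the gate does not depend on the orientation of the edge
  (\<open>cz_gate_commute\<close>); the definition below uses the increasing one.
\<close>

definition cz_edge :: "complex mat \<Rightarrow> nat set \<Rightarrow> qvec \<Rightarrow> qvec" where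
  "cz_edge H e = cz_gate H (Min e) (Max e)"

lemma cz_gate_commute:
  assumes "H \<in> carrier_mat d d" "symmetric_mat H"
    and "a \<in> {1..n}" "b \<in> {1..n}" "\<psi> \<in> qudit_space n d"
  shows "cz_gate H a b \<psi> = cz_gate H b a \<psi>"
proof
  fix x
  show "cz_gate H a b \<psi> x = cz_gate H b a \<psi> x"
  proof (cases "x \<in> basis_labels n d")
    case True
    then have "x a < d" "x b < d"
      using assms(3,4) by (auto simp: basis_labels_def PiE_def Pi_def)
    then have "H $$ (x a, x b) = H $$ (x b, x a)"
      using assms(1,2) by (metis carrier_matD index_transpose_mat(1) symmetric_mat_def)
    then show ?thesis by (simp add: cz_gate_def)
  next
    case False
    then show ?thesis using assms(5) by (simp add: cz_gate_def qudit_space_def)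
  qed
qed

lemma cz_edge_pair:
  assumes "H \<in> carrier_mat d d" "symmetric_mat H"
    and "a \<in> {1..n}" "b \<in> {1..n}" "\<psi> \<in> qudit_space n d"
  shows "cz_edge H {a, b} \<psi> = cz_gate H a b \<psi>"
  using cz_gate_commute[OF assms] by (auto simp: cz_edge_def min_def max_def)

text \<open>
  The product of the gates over all edges: they are applied one after the other, in an arbitrary
  order, which is immaterial because they commute.
\<close>

definition cz_edges :: "complex mat \<Rightarrow> nat set set \<Rightarrow> qvec \<Rightarrow> qvec" where
  "cz_edges H E \<psi> = Finite_Set.fold (cz_edge H) \<psi> E"

interpretation cz_edge: comp_fun_commute "cz_edge H" for H
  by unfold_locales (auto simp: cz_edge_def cz_gate_def fun_eq_iff)

lemma cz_edges_empty [simp]: "cz_edges H {} \<psi> = \<psi>"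
  by (simp add: cz_edges_def)

lemma cz_edges_insert:
  "finite E \<Longrightarrow> e \<notin> E \<Longrightarrow> cz_edges H (insert e E) \<psi> = cz_edge H e (cz_edges H E \<psi>)"
  by (simp add: cz_edges_def)

definition graph_op :: "nat \<Rightarrow> nat \<Rightarrow> nat set set \<Rightarrow> complex mat \<Rightarrow> qvec \<Rightarrow> qvec" where
  "graph_op n d E H \<psi> =
     (\<lambda>x. complex_of_real (1 / real d powr (real n / 2)) *
          cz_edges H E (tensor_op n d (\<lambda>_. H) \<psi>) x)"

definition graph_state :: "nat \<Rightarrow> nat \<Rightarrow> nat set set \<Rightarrow> complex mat \<Rightarrow> qvec" where
  "graph_state n d E H = graph_op n d E H (ket_zero n)"

end

theory Submission
  imports Defs
begin

text \<open>
  In the computational basis the amplitude of a graph state at x is, up to the normalisation, the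
  product of \<open>H(x\<^sub>a, x\<^sub>b)\<close> over the edges times the product of \<open>H(x\<^sub>v, 0)\<close> over the vertices.
  Equivalence of the two matrices reads \<open>H2(i, j) = \<alpha>(i) \<beta>(j) H1(\<sigma> i, \<tau> j)\<close> with phases \<open>\<alpha>, \<beta>\<close>.
  Orienting every edge from the first to the second side of the bipartition, this turns one
  amplitude into the other if \<open>\<sigma>\<close> acts on the labels of the first side, \<open>\<tau>\<close> acts on those of the
  second side, and the vertex v collects the phase \<open>\<alpha>(x\<^sub>v)\<close> or \<open>\<beta>(x\<^sub>v)\<close> once for each incident
  edge. Permutations and phases of the labels of one vertex are local unitaries.
\<close>

subsection \<open>Amplitudes of graph states\<close>

lemma basis_labels_less: "x \<in> basis_labels n d \<Longrightarrow> v \<in> {1..n} \<Longrightarrow> x v < d"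
  by (auto simp: basis_labels_def PiE_def Pi_def)

lemma finite_basis_labels [simp]: "finite (basis_labels n d)"
  by (simp add: basis_labels_def finite_PiE)

lemma restrict_in_basis_labels:
  "(\<And>v. v \<in> {1..n} \<Longrightarrow> f v < d) \<Longrightarrow> (\<lambda>v\<in>{1..n}. f v) \<in> basis_labels n d"
  by (auto simp: basis_labels_def)

lemma cz_edges_apply:
  assumes "finite E"
  shows "cz_edges H E \<psi> x = (\<Prod>e\<in>E. H $$ (x (Min e), x (Max e))) * \<psi> x"
  using assms
  by (induction E) (simp_all add: cz_edges_insert cz_edge_def cz_gate_def mult.assoc)

lemma tensor_op_ket_zero:
  assumes "d \<ge> 1" "x \<in> basis_labels n d"
  shows "tensor_op n d A (ket_zero n) x = (\<Prod>v\<in>{1..n}. A v $$ (x v, 0))"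
proof -
  let ?z = "\<lambda>v\<in>{1..n}. 0 :: nat"
  \<comment> \<open>This is where \<open>d \<ge> 1\<close> enters: the all-zero labelling has to be
    a basis label.\<close>
  have z: "?z \<in> basis_labels n d"
    using assms(1) by (intro restrict_in_basis_labels) auto
  have "tensor_op n d A (ket_zero n) x =
      (\<Sum>y\<in>basis_labels n d. if y = ?z then \<Prod>v\<in>{1..n}. A v $$ (x v, y v) else 0)"
    using assms(2) by (simp add: tensor_op_def ket_zero_def ket_def if_distrib cong: if_cong del: One_nat_def)
  also have "\<dots> = (\<Prod>v\<in>{1..n}. A v $$ (x v, ?z v))"
    using z by simp
  also have "\<dots> = (\<Prod>v\<in>{1..n}. A v $$ (x v, 0))"
    by (intro prod.cong) auto
  finally show ?thesis .
qed

lemma simple_graph_finite: "simple_graph n E \<Longrightarrow> finite E"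
  by (rule finite_subset[of E "Pow {1..n}"]) (auto simp: simple_graph_def)

lemma graph_state_apply:
  assumes "d \<ge> 1" "finite E" "x \<in> basis_labels n d"
  shows "graph_state n d E H x = complex_of_real (1 / real d powr (real n / 2)) *
    ((\<Prod>e\<in>E. H $$ (x (Min e), x (Max e))) * (\<Prod>v\<in>{1..n}. H $$ (x v, 0)))"
  using assms
  by (simp add: graph_state_def graph_op_def cz_edges_apply tensor_op_ket_zero)

lemma graph_state_in_qudit_space:
  "finite E \<Longrightarrow> graph_state n d E H \<in> qudit_space n d"
  by (simp add: qudit_space_def graph_state_def graph_op_def cz_edges_apply tensor_op_def)

lemma symmetric_mat_index:
  assumes "H \<in> carrier_mat d d" "symmetric_mat H" "i < d" "j < d"
  shows "H $$ (i, j) = H $$ (j, i)"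
  using assms by (metis carrier_matD index_transpose_mat(1) symmetric_mat_def)

text \<open>Gates are indexed by \<open>Min\<close> and \<open>Max\<close>, whereas a bipartition
  orients each edge its own way; symmetry of \<open>H\<close> makes the two orientations
  agree.\<close>

lemma symmetric_mat_edge:
  assumes "H \<in> carrier_mat d d" "symmetric_mat H" "x a < d" "x b < d"
  shows "H $$ (x (Min {a, b}), x (Max {a, b})) = H $$ (x a, x b)"
  using symmetric_mat_index[OF assms] by (auto simp: min_def max_def)

subsection \<open>Monomial local unitaries\<close>

lemma mat_adjoint_index:
  "A \<in> carrier_mat n m \<Longrightarrow> i < m \<Longrightarrow> j < n \<Longrightarrow> mat_adjoint A $$ (i, j) = conjugate (A $$ (j, i))"
  by (simp add: mat_adjoint_def mat_of_rows_index)

lemma unitary_monomial_mat: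
  fixes g :: "nat \<Rightarrow> complex"
  assumes \<sigma>: "\<sigma> permutes {0..<d}" and g: "\<And>i. i < d \<Longrightarrow> cmod (g i) = 1"
  shows "unitary_mat d (mat d d (\<lambda>(i, j). if j = \<sigma> i then g i else 0))"
proof -
  define U where "U = mat d d (\<lambda>(i, j). if j = \<sigma> i then g i else 0)"
  have U: "U \<in> carrier_mat d d" by (simp add: U_def)
  have A: "mat_adjoint U \<in> carrier_mat d d"
    using U by (auto simp: mat_adjoint_def)
  have \<sigma>_less: "\<sigma> i < d" if "i < d" for i
    using permutes_in_image[OF \<sigma>, of i] that by simp
  \<comment> \<open>The rows are easier than the columns: row \<open>i\<close> is a phase times the
    basis vector at \<open>\<sigma> i\<close>. For square matrices a right inverse is also a left
    inverse.\<close>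
  have "U * mat_adjoint U = 1\<^sub>m d"
  proof (rule eq_matI)
    fix i j assume "i < dim_row (1\<^sub>m d :: complex mat)" "j < dim_col (1\<^sub>m d :: complex mat)"
    then have ij: "i < d" "j < d" by auto
    have "(U * mat_adjoint U) $$ (i, j) = (\<Sum>k<d. U $$ (i, k) * cnj (U $$ (j, k)))"
      using U A ij
      by (simp add: scalar_prod_def mat_adjoint_index[OF U] atLeast0LessThan)
    also have "\<dots> = (\<Sum>k<d. if k = \<sigma> i then g i * (if \<sigma> i = \<sigma> j then cnj (g j) else 0) else 0)"
      using ij by (intro sum.cong) (auto simp: U_def)
    also have "\<dots> = g i * (if i = j then cnj (g j) else 0)"
      using \<sigma>_less[OF ij(1)] permutes_inj[OF \<sigma>] by (auto simp: inj_eq)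
    also have "\<dots> = 1\<^sub>m d $$ (i, j)"
      using ij g[of i] by (auto simp: complex_norm_square[symmetric])
    finally show "(U * mat_adjoint U) $$ (i, j) = 1\<^sub>m d $$ (i, j)" .
  qed (use U A in auto)
  then show ?thesis
    using mat_mult_left_right_inverse[OF U A] U by (simp add: unitary_mat_def U_def)
qed

text \<open>Row \<open>x\<close> of a tensor product of monomial matrices has its only nonzero entry
  in the column with labels \<open>\<sigma> v (x v)\<close>, so the operator reads
  \<open>\<psi>1\<close> there and multiplies by the phases.\<close>

lemma lu_equiv_monomial:
  assumes spaces: "\<psi>1 \<in> qudit_space n d" "\<psi>2 \<in> qudit_space n d"
    and \<sigma>: "\<And>v. v \<in> {1..n} \<Longrightarrow> \<sigma> v permutes {0..<d}"
    and g: "\<And>v i. v \<in> {1..n} \<Longrightarrow> i < d \<Longrightarrow> cmod (g v i) = 1"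
    and eq: "\<And>x. x \<in> basis_labels n d \<Longrightarrow>
      \<psi>2 x = (\<Prod>v\<in>{1..n}. g v (x v)) * \<psi>1 (\<lambda>v\<in>{1..n}. \<sigma> v (x v))"
  shows "lu_equiv n d \<psi>1 \<psi>2"
proof -
  define U where "U v = mat d d (\<lambda>(i, j). if j = \<sigma> v i then g v i else 0)" for v
  have "tensor_op n d U \<psi>1 x = \<psi>2 x" for x
  proof (cases "x \<in> basis_labels n d")
    case x: True
    let ?y = "\<lambda>v\<in>{1..n}. \<sigma> v (x v)"
    have y: "?y \<in> basis_labels n d"
      using basis_labels_less[OF x] permutes_in_image[OF \<sigma>]
      by (intro restrict_in_basis_labels) auto
    have entry: "(\<Prod>v\<in>{1..n}. U v $$ (x v, y v)) =
        (if y = ?y then \<Prod>v\<in>{1..n}. g v (x v) else 0)" if y: "y \<in> basis_labels n d" for y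
    proof (cases "y = ?y")
      case True
      then show ?thesis
        using basis_labels_less[OF x] basis_labels_less[OF y]
        by (auto simp: U_def intro!: prod.cong)
    next
      case False
      \<comment> \<open>Both labellings are extensional, so they can only differ at a vertex; the
        zero factor there kills the whole product.\<close>
      have "\<exists>v\<in>{1..n}. y v \<noteq> ?y v"
        using False y PiE_ext[of y "{1..n}" "\<lambda>_. {0..<d}" ?y] \<open>?y \<in> basis_labels n d\<close>
        by (auto simp: basis_labels_def)
      then obtain v where v: "v \<in> {1..n}" "y v \<noteq> \<sigma> v (x v)" by auto
      then have "U v $$ (x v, y v) = 0"
        using basis_labels_less[OF x] basis_labels_less[OF y] by (simp add: U_def)
      then have "(\<Prod>v\<in>{1..n}. U v $$ (x v, y v)) = 0"
        using v(1) by (intro prod_zero) auto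
      then show ?thesis using False by simp
    qed
    have "tensor_op n d U \<psi>1 x =
        (\<Sum>y\<in>basis_labels n d. if y = ?y then (\<Prod>v\<in>{1..n}. g v (x v)) * \<psi>1 y else 0)"
      using x by (simp add: tensor_op_def entry if_distrib[of "\<lambda>c. c * _"] cong: sum.cong if_cong del: One_nat_def)
    also have "\<dots> = \<psi>2 x"
      using y by (simp add: eq[OF x])
    finally show ?thesis .
  next
    case False
    then show ?thesis using spaces(2) by (simp add: tensor_op_def qudit_space_def)
  qed
  moreover have "unitary_mat d (U v)" if "v \<in> {1..n}" for v
    unfolding U_def using \<sigma> g that by (intro unitary_monomial_mat) auto
  ultimately show ?thesis
    using spaces unfolding lu_equiv_def by blast
qed

subsection \<open>Equivalent Hadamard matrices\<close>

lemma diagonal_mult_index: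
  fixes D :: "'a :: semiring_1 mat"
  assumes "D \<in> carrier_mat d d" "diagonal_mat D" "A \<in> carrier_mat d d" "i < d" "j < d"
  shows "(D * A) $$ (i, j) = D $$ (i, i) * A $$ (i, j)"
proof -
  have "(D * A) $$ (i, j) = (\<Sum>k<d. D $$ (i, k) * A $$ (k, j))"
    using assms by (simp add: scalar_prod_def atLeast0LessThan)
  also have "\<dots> = (\<Sum>k<d. if k = i then D $$ (i, i) * A $$ (i, j) else 0)"
    using assms by (intro sum.cong) (auto simp: diagonal_mat_def)
  finally show ?thesis using assms by simp
qed

lemma mult_diagonal_index:
  fixes D :: "'a :: semiring_1 mat"
  assumes "D \<in> carrier_mat d d" "diagonal_mat D" "A \<in> carrier_mat d d" "i < d" "j < d"
  shows "(A * D) $$ (i, j) = A $$ (i, j) * D $$ (j, j)"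
proof -
  have "(A * D) $$ (i, j) = (\<Sum>k<d. A $$ (i, k) * D $$ (k, j))"
    using assms by (simp add: scalar_prod_def atLeast0LessThan)
  also have "\<dots> = (\<Sum>k<d. if k = j then A $$ (i, j) * D $$ (j, j) else 0)"
    using assms by (intro sum.cong) (auto simp: diagonal_mat_def)
  finally show ?thesis using assms by simp
qed

text \<open>Left multiplication carries row \<open>i\<close> to row \<open>\<pi> i\<close>.
  Evaluating at \<open>\<pi> i\<close> keeps the inverse permutation out of the formula.\<close>

lemma permutation_mult_index:
  assumes "\<pi> permutes {0..<d}" "A \<in> carrier_mat d d" "i < d" "j < d"
  shows "(mat d d (\<lambda>(i, j). if i = \<pi> j then 1 else (0 :: complex)) * A) $$ (\<pi> i, j) = A $$ (i, j)"
proof -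
  have \<pi>i: "\<pi> i < d" using permutes_in_image[OF assms(1), of i] assms(3) by simp
  have "(mat d d (\<lambda>(i, j). if i = \<pi> j then 1 else (0 :: complex)) * A) $$ (\<pi> i, j) =
      (\<Sum>k<d. (if \<pi> i = \<pi> k then 1 else 0) * A $$ (k, j))"
    using assms \<pi>i by (simp add: scalar_prod_def atLeast0LessThan)
  also have "\<dots> = (\<Sum>k<d. if k = i then A $$ (i, j) else 0)"
    using permutes_inj[OF assms(1)] by (intro sum.cong) (auto simp: inj_eq)
  finally show ?thesis using assms by simp
qed

lemma mult_permutation_index:
  assumes "\<pi> permutes {0..<d}" "A \<in> carrier_mat d d" "i < d" "j < d"
  shows "(A * mat d d (\<lambda>(i, j). if i = \<pi> j then 1 else (0 :: complex))) $$ (i, j) = A $$ (i, \<pi> j)"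
proof -
  have \<pi>j: "\<pi> j < d" using permutes_in_image[OF assms(1), of j] assms(4) by simp
  have "(A * mat d d (\<lambda>(i, j). if i = \<pi> j then 1 else (0 :: complex))) $$ (i, j) =
      (\<Sum>k<d. A $$ (i, k) * (if k = \<pi> j then 1 else 0))"
    using assms by (simp add: scalar_prod_def atLeast0LessThan)
  also have "\<dots> = (\<Sum>k<d. if k = \<pi> j then A $$ (i, \<pi> j) else 0)"
    by (intro sum.cong) auto
  finally show ?thesis using \<pi>j by simp
qed

text \<open>The matrix identity is read at entry \<open>(\<sigma> i, \<tau> j)\<close> and solved
  for \<open>H2\<close>. All entries of \<open>H1\<close> and \<open>H2\<close> have modulus 1, so
  the diagonal factors amount to phases.\<close>

lemma hadamard_equivE:
  assumes "hadamard_mat d H1" "hadamard_mat d H2" "hadamard_equiv d H1 H2"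
  obtains \<sigma> \<tau> and \<alpha> \<beta> :: "nat \<Rightarrow> complex"
  where "\<sigma> permutes {0..<d}" "\<tau> permutes {0..<d}"
    "\<And>i. i < d \<Longrightarrow> cmod (\<alpha> i) = 1" "\<And>i. i < d \<Longrightarrow> cmod (\<beta> i) = 1"
    "\<And>i j. i < d \<Longrightarrow> j < d \<Longrightarrow> H2 $$ (i, j) = \<alpha> i * \<beta> j * H1 $$ (\<sigma> i, \<tau> j)"
proof -
  obtain P1 P2 D1 D2 where P: "permutation_mat d P1" "permutation_mat d P2"
    and D1: "D1 \<in> carrier_mat d d" "diagonal_mat D1"
    and D2: "D2 \<in> carrier_mat d d" "diagonal_mat D2"
    and H: "H1 = D1 * P1 * H2 * P2 * D2"
    using assms(3) unfolding hadamard_equiv_def by blast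
  obtain \<sigma> where \<sigma>: "\<sigma> permutes {0..<d}"
    and P1: "P1 = mat d d (\<lambda>(i, j). if i = \<sigma> j then 1 else 0)"
    using P(1) unfolding permutation_mat_def by blast
  obtain \<pi> where \<pi>: "\<pi> permutes {0..<d}"
    and P2: "P2 = mat d d (\<lambda>(i, j). if i = \<pi> j then 1 else 0)"
    using P(2) unfolding permutation_mat_def by blast
  \<comment> \<open>Right multiplication by \<open>P2\<close> reads column \<open>\<pi> j\<close>,
    so the inverse is needed to land on column \<open>j\<close> of \<open>H2\<close>.\<close>
  define \<tau> where "\<tau> = inv_into UNIV \<pi>"
  have \<tau>: "\<tau> permutes {0..<d}" using permutes_inv[OF \<pi>] by (simp add: \<tau>_def)
  have H2: "H2 \<in> carrier_mat d d" using assms(2) by (simp add: hadamard_mat_def)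
  have P1c: "P1 \<in> carrier_mat d d" and P2c: "P2 \<in> carrier_mat d d" by (auto simp: P1 P2)
  define a where "a i = D1 $$ (\<sigma> i, \<sigma> i)" for i
  define b where "b j = D2 $$ (\<tau> j, \<tau> j)" for j
  have less: "\<sigma> i < d" "\<tau> i < d" if "i < d" for i
    using permutes_in_image[OF \<sigma>, of i] permutes_in_image[OF \<tau>, of i] that by auto
  have H1_eq: "H1 $$ (\<sigma> i, \<tau> j) = a i * b j * H2 $$ (i, j)" if ij: "i < d" "j < d" for i j
  proof -
    have c: "P1 * H2 \<in> carrier_mat d d" "D1 * (P1 * H2) \<in> carrier_mat d d"
      "D1 * (P1 * H2) * P2 \<in> carrier_mat d d"
      using P1c P2c D1 H2 by auto
    \<comment> \<open>With this bracketing the factors peel off one at a time: \<open>D2\<close>,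
      \<open>P2\<close>, \<open>D1\<close>, then \<open>P1\<close>.\<close>
    have "H1 = D1 * (P1 * H2) * P2 * D2"
      using H D1 P1c H2 by simp
    then have "H1 $$ (\<sigma> i, \<tau> j) = (D1 * (P1 * H2) * P2) $$ (\<sigma> i, \<tau> j) * b j"
      using mult_diagonal_index[OF D2 c(3)] less ij by (simp add: b_def)
    also have "\<dots> = (D1 * (P1 * H2)) $$ (\<sigma> i, j) * b j"
      unfolding P2 using mult_permutation_index[OF \<pi> c(2)] less ij
      by (simp add: \<tau>_def permutes_inverses(1)[OF \<pi>])
    also have "\<dots> = a i * (P1 * H2) $$ (\<sigma> i, j) * b j"
      using diagonal_mult_index[OF D1 c(1)] less ij by (simp add: a_def)
    also have "(P1 * H2) $$ (\<sigma> i, j) = H2 $$ (i, j)"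
      unfolding P1 by (rule permutation_mult_index[OF \<sigma> H2 ij])
    finally show ?thesis by (simp add: mult_ac)
  qed
  have ab: "cmod (a i * b j) = 1" if "i < d" "j < d" for i j
  proof -
    have "cmod (H1 $$ (\<sigma> i, \<tau> j)) = 1" "cmod (H2 $$ (i, j)) = 1"
      using assms(1,2) less that by (auto simp: hadamard_mat_def)
    then show ?thesis by (simp add: H1_eq[OF that] norm_mult)
  qed
  \<comment> \<open>The entries of D1 and D2 need not be phases themselves, only their products are.\<close>
  have sgn_ab: "sgn (a i) * sgn (b j) = a i * b j" if "i < d" "j < d" for i j
  proof -
    have "sgn (a i) * sgn (b j) = sgn (a i * b j)" by (simp add: sgn_mult)
    also have "\<dots> = a i * b j" using ab[OF that] by (simp add: sgn_eq)
    finally show ?thesis .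
  qed
  \<comment> \<open>The diagonal case \<open>j = i\<close> of \<open>ab\<close> suffices.\<close>
  have nz: "a i \<noteq> 0" "b i \<noteq> 0" if "i < d" for i
    using ab[OF that that] by auto
  show ?thesis
  proof (rule that[of \<sigma> \<tau> "\<lambda>i. inverse (sgn (a i))" "\<lambda>j. inverse (sgn (b j))"])
    show "H2 $$ (i, j) = inverse (sgn (a i)) * inverse (sgn (b j)) * H1 $$ (\<sigma> i, \<tau> j)"
      if ij: "i < d" "j < d" for i j
    proof -
      have "inverse (sgn (a i)) * inverse (sgn (b j)) = inverse (a i * b j)"
        by (simp flip: sgn_ab[OF ij])
      then show ?thesis using nz(1)[OF ij(1)] nz(2)[OF ij(2)] by (simp add: H1_eq[OF ij] field_simps)
    qed
  qed (use \<sigma> \<tau> nz in \<open>auto simp: norm_inverse norm_sgn\<close>)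
qed

text \<open>Incidences are counted from the vertex side: \<open>f v\<close> occurs once for each
  edge at \<open>v\<close>. This turns phases attached to edges into local ones.\<close>

lemma prod_edges_eq_prod_vertices:
  fixes f :: "'v \<Rightarrow> 'a :: comm_monoid_mult"
  assumes "finite E" "finite V" "\<And>e. e \<in> E \<Longrightarrow> e \<subseteq> V"
  shows "(\<Prod>e\<in>E. \<Prod>v\<in>e. f v) = (\<Prod>v\<in>V. f v ^ card {e \<in> E. v \<in> e})"
proof -
  have "(\<Prod>e\<in>E. \<Prod>v\<in>e. f v) = (\<Prod>e\<in>E. \<Prod>v\<in>{v \<in> V. v \<in> e}. f v)"
    using assms(3) by (intro prod.cong) auto
  also have "\<dots> = (\<Prod>v\<in>V. \<Prod>e\<in>{e \<in> E. v \<in> e}. f v)"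
    by (rule prod.swap_restrict[OF assms(1,2)])
  finally show ?thesis by simp
qed

theorem theorem15:
  fixes n d :: nat and E :: "nat set set" and H1 H2 :: "complex mat"
  assumes "d \<ge> 1"
    and "simple_graph n E" and "bipartite n E"
    and "hadamard_mat d H1" and "symmetric_mat H1"
    and "hadamard_mat d H2" and "symmetric_mat H2"
    and "hadamard_equiv d H1 H2"
  shows "lu_equiv n d (graph_state n d E H1) (graph_state n d E H2)"
proof -
  obtain \<sigma> \<tau> \<alpha> \<beta> where perm: "\<sigma> permutes {0..<d}" "\<tau> permutes {0..<d}"
    and phase: "\<And>i. i < d \<Longrightarrow> cmod (\<alpha> i) = 1" "\<And>i. i < d \<Longrightarrow> cmod (\<beta> i) = 1"
    and H2_eq: "\<And>i j. i < d \<Longrightarrow> j < d \<Longrightarrow> H2 $$ (i, j) = \<alpha> i * \<beta> j * H1 $$ (\<sigma> i, \<tau> j)"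
    using hadamard_equivE[OF assms(4,6,8)] by metis
  obtain V1 V2 where V: "V1 \<union> V2 = {1..n}" "V1 \<inter> V2 = {}"
    and edges: "\<forall>e\<in>E. \<exists>a\<in>V1. \<exists>b\<in>V2. e = {a, b}"
    using assms(3) unfolding bipartite_def by (elim exE conjE) (rule that)
  have finE: "finite E" using assms(2) by (rule simple_graph_finite)
  have carrier: "H1 \<in> carrier_mat d d" "H2 \<in> carrier_mat d d"
    and unimod: "\<And>i j. i < d \<Longrightarrow> j < d \<Longrightarrow> cmod (H1 $$ (i, j)) = 1"
      "\<And>i j. i < d \<Longrightarrow> j < d \<Longrightarrow> cmod (H2 $$ (i, j)) = 1"
    using assms(4,6) by (auto simp: hadamard_mat_def)
  define \<rho> where "\<rho> v = (if v \<in> V1 then \<sigma> else \<tau>)" for v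
  define \<gamma> where "\<gamma> v = (if v \<in> V1 then \<alpha> else \<beta>)" for v
  define deg where "deg v = card {e \<in> E. v \<in> e}" for v
  \<comment> \<open>The quotient of the entries in column 0 corrects the layer \<open>H\<^sup>\<otimes>\<^sup>n\<close>, which acts on
    \<open>|0\<rangle>\<close> before the gates and contributes \<open>H(x\<^sub>v, 0)\<close> at v.\<close>
  define g where "g v i = \<gamma> v i ^ deg v * (H2 $$ (i, 0) / H1 $$ (\<rho> v i, 0))" for v i
  have \<rho>: "\<rho> v permutes {0..<d}" for v
    using perm by (simp add: \<rho>_def)
  have \<rho>_less: "\<rho> v i < d" if "i < d" for v i
    using permutes_in_image[OF \<rho>[of v], of i] that by simp
  show ?thesis
  proof (rule lu_equiv_monomial[where \<sigma> = \<rho> and g = g])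
    \<comment> \<open>Every ingredient of \<open>g\<close> is unimodular; \<open>d \<ge> 1\<close>
      ensures that column 0 exists.\<close>
    show "cmod (g v i) = 1" if "i < d" for v i
      using that phase unimod \<rho>_less[OF that] assms(1)
      by (simp add: g_def \<gamma>_def norm_mult norm_power norm_divide)
  next
    fix x assume x: "x \<in> basis_labels n d"
    let ?y = "\<lambda>v\<in>{1..n}. \<rho> v (x v)"
    have y: "?y \<in> basis_labels n d"
      using basis_labels_less[OF x] \<rho>_less by (intro restrict_in_basis_labels) auto
    have edge: "H2 $$ (x (Min e), x (Max e)) =
        (\<Prod>v\<in>e. \<gamma> v (x v)) * H1 $$ (?y (Min e), ?y (Max e))" if e: "e \<in> E" for e
    proof -
      obtain a b where ab: "a \<in> V1" "b \<in> V2" "e = {a, b}" using bspec[OF edges e] by (elim bexE) (rule that)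
      \<comment> \<open>Disjointness of the two sides puts \<open>b\<close> in the else branch of
        \<open>\<gamma>\<close> and \<open>\<rho>\<close>, and \<open>a \<noteq> b\<close> splits
        the product over \<open>e\<close> into two factors.\<close>
      then have neq: "a \<noteq> b" "b \<notin> V1" and mem: "a \<in> {1..n}" "b \<in> {1..n}" using V by auto
      have less: "x a < d" "x b < d" "?y a < d" "?y b < d"
        using basis_labels_less[OF x] basis_labels_less[OF y] mem by blast+
      have "H2 $$ (x (Min e), x (Max e)) = H2 $$ (x a, x b)"
        unfolding ab by (intro symmetric_mat_edge[where d = d] carrier assms less)
      also have "\<dots> = \<alpha> (x a) * \<beta> (x b) * H1 $$ (\<sigma> (x a), \<tau> (x b))"
        by (rule H2_eq[OF less(1,2)])
      also have "\<dots> = (\<Prod>v\<in>e. \<gamma> v (x v)) * H1 $$ (?y a, ?y b)"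
        using ab neq mem by (simp add: \<gamma>_def \<rho>_def)
      also have "H1 $$ (?y a, ?y b) = H1 $$ (?y (Min e), ?y (Max e))"
        unfolding ab by (intro symmetric_mat_edge[where d = d, symmetric] carrier assms less)
      finally show ?thesis .
    qed
    have sub: "e \<subseteq> {1..n}" if "e \<in> E" for e
      using assms(2) that by (auto simp: simple_graph_def)
    have E_prod: "(\<Prod>e\<in>E. H2 $$ (x (Min e), x (Max e))) =
        (\<Prod>v\<in>{1..n}. \<gamma> v (x v) ^ deg v) * (\<Prod>e\<in>E. H1 $$ (?y (Min e), ?y (Max e)))"
      using prod_edges_eq_prod_vertices[OF finE finite_atLeastAtMost sub, where f = "\<lambda>v. \<gamma> v (x v)"]
      by (simp add: edge prod.distrib deg_def cong: prod.cong)
    have "g v (x v) * H1 $$ (?y v, 0) = \<gamma> v (x v) ^ deg v * H2 $$ (x v, 0)"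
      if v: "v \<in> {1..n}" for v
    proof -
      have "\<rho> v (x v) < d" "0 < d"
        using \<rho>_less basis_labels_less[OF x v] assms(1) by auto
      \<comment> \<open>A unimodular entry is nonzero, so the denominator in \<open>g\<close>
        cancels.\<close>
      then have "H1 $$ (\<rho> v (x v), 0) \<noteq> 0"
        using unimod(1) by fastforce
      then show ?thesis using v by (simp add: g_def)
    qed
    then have "(\<Prod>v\<in>{1..n}. g v (x v) * H1 $$ (?y v, 0)) =
        (\<Prod>v\<in>{1..n}. \<gamma> v (x v) ^ deg v * H2 $$ (x v, 0))"
      by (intro prod.cong) auto
    then have V_prod: "(\<Prod>v\<in>{1..n}. g v (x v)) * (\<Prod>v\<in>{1..n}. H1 $$ (?y v, 0)) =
        (\<Prod>v\<in>{1..n}. \<gamma> v (x v) ^ deg v) * (\<Prod>v\<in>{1..n}. H2 $$ (x v, 0))"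
      by (simp only: prod.distrib)
    \<comment> \<open>Here \<open>c\<close> is the normalisation, \<open>p\<close> the edge product
      for \<open>H1\<close>, \<open>u\<close> and \<open>w\<close> the column 0 products of
      \<open>H1\<close> and \<open>H2\<close>, \<open>a\<close> the collected edge phases and
      \<open>b\<close> the product of the \<open>g v (x v)\<close>.\<close>
    have rearrange: "c * (a * p * w) = b * (c * (p * u))" if "b * u = a * w"
      for a b c p u w :: complex
    proof -
      have "c * (a * p * w) = c * p * (a * w)" by (simp add: mult_ac)
      also have "\<dots> = b * (c * (p * u))" by (simp add: mult_ac flip: that)
      finally show ?thesis .
    qed
    show "graph_state n d E H2 x = (\<Prod>v\<in>{1..n}. g v (x v)) * graph_state n d E H1 ?y"
      unfolding graph_state_apply[OF assms(1) finE x] graph_state_apply[OF assms(1) finE y] E_prod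
      by (rule rearrange[OF V_prod])
  qed (use \<rho> graph_state_in_qudit_space[OF finE] in auto)
qed

end
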